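(* Let $l, m \in \mathbb{Z}$ with $l < m$, let $a_j \in \mathbb{C}$ for $l \le j \le m$ with $a_l \neq 0$ and $a_m \neq 0$, and let $\lambda \in \mathbb{C}\setminus\{0\}$. Let $T : \mathbb{C}[x] \to \mathbb{C}[x]$ be the linear finite difference operator $$T(P)(x) = \sum_{j=l}^m a_j P(x - j\lambda),$$ and let $Q(t) = \sum_{j=l}^m a_j t^j$ be its generating rational function. Then $T$ preserves the set $\mathcal{HP}$ of hyperbolic polynomials (that is, $T(P) \in \mathcal{HP}$ for every $P \in \mathcal{HP}$) if and only if all of the following conditions are satisfied: 1. $\operatorname{Re} \lambda = 0$; 2. $l = -m$; 3. all roots of the generating function $Q$ belong to the unit circle $\{z : |z| = 1\}$; 4. $a_{-m} \cdot a_m \in (0, +\infty)$.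
   Context: A real polynomial $P \in \mathbb{R}[x]$ is called hyperbolic (or real-rooted) if all its zeros are real or if $P$ is identically zero; nonzero real constants are hyperbolic. $\mathcal{HP} \subset \mathbb{R}[x]$ denotes the set of hyperbolic polynomials. *)

theory Defs
  imports "HOL-Analysis.Analysis" "HOL-Computational_Algebra.Polynomial"
begin

abbreviation complexify :: "real poly \<Rightarrow> complex poly" where
  "complexify \<equiv> map_poly complex_of_real"

definition hyperbolic :: "real poly \<Rightarrow> bool" where
  "hyperbolic P \<longleftrightarrow> P = 0 \<or> (\<forall>z. poly (complexify P) z = 0 \<longrightarrow> z \<in> \<real>)"

definition HP :: "real poly set" where
  "HP = {P. hyperbolic P}"

(* Composition with the linear polynomial x - j * lam realizes P(x - j * lam). *)
definition fin_diff_op ::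
  "int \<Rightarrow> int \<Rightarrow> (int \<Rightarrow> complex) \<Rightarrow> complex \<Rightarrow> complex poly \<Rightarrow> complex poly" where
  "fin_diff_op l m a lam P =
     (\<Sum>j\<in>{l..m}. smult (a j) (pcompose P [: - (of_int j * lam), 1 :]))"

(* Real polynomials are regarded as complex ones with real coefficients, so preservation
   includes the claim that the image polynomial has real coefficients. *)
definition preserves_HP :: "(complex poly \<Rightarrow> complex poly) \<Rightarrow> bool" where
  "preserves_HP T \<longleftrightarrow> (\<forall>P\<in>HP. T (complexify P) \<in> complexify ` HP)"

definition gen_fun :: "int \<Rightarrow> int \<Rightarrow> (int \<Rightarrow> complex) \<Rightarrow> complex \<Rightarrow> complex" where
  "gen_fun l m a t = (\<Sum>j\<in>{l..m}. a j * t powi j)"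

(* For l < 0 (and a l nonzero) the rational function has a pole at 0, where powi takes the
   convention value 0; the point 0 is therefore excluded. For l >= 0 the function is
   a polynomial, and gen_fun has the right value at 0 because 0 powi 0 = 1. *)
definition gen_fun_roots :: "int \<Rightarrow> int \<Rightarrow> (int \<Rightarrow> complex) \<Rightarrow> complex set" where
  "gen_fun_roots l m a = {t. (t \<noteq> 0 \<or> 0 \<le> l) \<and> gen_fun l m a t = 0}"

end

theory Submission
  imports Defs "HOL-Complex_Analysis.Great_Picard"
    "HOL-Computational_Algebra.Fundamental_Theorem_Algebra"
begin

text \<open>
  Necessity: \<open>T (x^n)\<close>, read backwards and rescaled, is \<open>\<Sum>j. a j * (1 - j * lam * s / n) ^ n\<close>,
  which converges locally uniformly to \<open>Q (exp (- lam * s))\<close>. If \<open>T\<close> preserves hyperbolicity, this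
  limit is real on the real axis and, by Hurwitz, has only real zeros. As \<open>s\<close> and
  \<open>s + 2 * pi * i / lam\<close> are zeros together, \<open>lam\<close> is imaginary; then the roots of \<open>Q\<close> are
  unimodular, and \<open>Q\<close> is real on the unit circle, that is \<open>a (- j) = cnj (a j)\<close>.

  Sufficiency: let \<open>lam = i * \<mu>\<close> and \<open>cmod r = 1\<close>. If the zeros of \<open>P\<close> lie on the line
  \<open>Im z = c\<close>, then those of \<open>P (z - lam) - r * P z\<close> lie on \<open>Im z = c + \<mu> / 2\<close>. Composing these
  operators over all \<open>2 * m\<close> roots of \<open>t ^ m * Q t\<close> and shifting back by \<open>m * lam\<close> shows that
  \<open>T P\<close> has only real zeros. The sign condition on \<open>a (- m) * a m\<close> makes \<open>Q\<close> self-inversive with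
  factor one, so that \<open>T P\<close> has real coefficients.
\<close>

section \<open>Comparing the modulus of a polynomial at two points\<close>

lemma poly_root_factor:
  fixes p :: "complex poly"
  assumes "degree p = Suc n"
  obtains r p' where "p = [:- r, 1:] * p'" "degree p' = n" "p' \<noteq> 0"
proof -
  from assms have "\<not> constant (poly p)" by (simp add: constant_degree)
  then obtain r where "poly p r = 0" using fundamental_theorem_of_algebra by blast
  then obtain p' where p': "p = [:- r, 1:] * p'" by (auto simp: poly_eq_0_iff_dvd)
  have "p' \<noteq> 0" using p' assms by auto
  moreover have "degree p' = n" using assms \<open>p' \<noteq> 0\<close> unfolding p' by (subst (asm) degree_mult_eq) auto
  ultimately show thesis using p' that by blast
qed

text \<open>Up to the leading coefficient, the modulus is the product of the distances to the roots,
  and every factor is smaller at \<open>w\<close>.\<close>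

lemma norm_poly_less:
  fixes p :: "complex poly"
  assumes "degree p > 0" and "\<And>r. poly p r = 0 \<Longrightarrow> norm (w - r) < norm (z - r)"
  shows "norm (poly p w) < norm (poly p z)"
  using assms
proof (induction "degree p" arbitrary: p)
  case (Suc n)
  obtain r p' where p': "p = [:- r, 1:] * p'" "degree p' = n" "p' \<noteq> 0"
    using poly_root_factor[of p n] Suc.hyps(2) by metis
  have r: "norm (w - r) < norm (z - r)"
    using Suc.prems(2)[of r] p'(1) by simp
  have roots: "norm (w - r) < norm (z - r)" if "poly p' r = 0" for r
    using Suc.prems(2)[of r] p'(1) that by simp
  \<comment> \<open>The cofactor may be constant, so only the weak inequality is available;
    positivity at \<open>z\<close> keeps the product strict.\<close>
  have "norm (poly p' w) \<le> norm (poly p' z) \<and> norm (poly p' z) > 0"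
  proof (cases "n = 0")
    case True
    then obtain c where "p' = [:c:]" using p'(2) degree_eq_zeroE by blast
    then show ?thesis using p'(3) by simp
  next
    case False
    then have "norm (poly p' w) < norm (poly p' z)"
      using Suc.hyps(1)[of p'] p'(2) roots by simp
    then show ?thesis by (smt (verit) norm_ge_zero)
  qed
  with r have "norm (w - r) * norm (poly p' w) < norm (z - r) * norm (poly p' z)"
    by (intro order_le_less_trans[OF mult_left_mono mult_strict_right_mono]) auto
  moreover have "poly p x = (x - r) * poly p' x" for x
    by (simp add: p'(1) algebra_simps)
  ultimately show ?case by (simp add: norm_mult)
qed simp

section \<open>Polynomials in a translation and zeros on horizontal lines\<close>

text \<open>This is \<open>q\<close> evaluated at the translation by \<open>lam\<close>, so factors
  of \<open>q\<close> turn into composed operators.\<close>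

definition shift_op :: "complex \<Rightarrow> complex poly \<Rightarrow> complex poly \<Rightarrow> complex poly" where
  "shift_op lam q P =
     (\<Sum>i\<le>degree q. smult (coeff q i) (pcompose P [: - (of_nat i * lam), 1 :]))"

lemma poly_shift_op:
  assumes "degree q \<le> n"
  shows "poly (shift_op lam q P) z = (\<Sum>i\<le>n. coeff q i * poly P (z - of_nat i * lam))"
proof -
  have "poly (shift_op lam q P) z = (\<Sum>i\<le>degree q. coeff q i * poly P (z - of_nat i * lam))"
    by (simp add: shift_op_def poly_sum poly_pcompose)
  also have "\<dots> = (\<Sum>i\<le>n. coeff q i * poly P (z - of_nat i * lam))"
    using assms by (intro sum.mono_neutral_left) (auto simp: coeff_eq_0)
  finally show ?thesis .
qed

lemma poly_shift_op_linear_mult: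
  "poly (shift_op lam ([:- r, 1:] * q) P) z
     = poly (shift_op lam q P) (z - lam) - r * poly (shift_op lam q P) z"
proof -
  let ?n = "degree q"
  have "degree ([:- r, 1:] * q) \<le> Suc ?n"
    using degree_mult_le[of "[:- r, 1:]" q] by simp
  then have "poly (shift_op lam ([:- r, 1:] * q) P) z
      = (\<Sum>i\<le>Suc ?n. coeff ([:- r, 1:] * q) i * poly P (z - of_nat i * lam))"
    by (rule poly_shift_op)
  also have "\<dots> = (\<Sum>i\<le>Suc ?n. coeff (pCons 0 q) i * poly P (z - of_nat i * lam))
      - r * (\<Sum>i\<le>Suc ?n. coeff q i * poly P (z - of_nat i * lam))"
    by (simp add: sum_distrib_left sum_subtractf algebra_simps del: sum.atMost_Suc)
  also have "(\<Sum>i\<le>Suc ?n. coeff q i * poly P (z - of_nat i * lam)) = poly (shift_op lam q P) z"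
    by (simp only: poly_shift_op[of q "Suc ?n"] le_SucI order_refl)
  also have "(\<Sum>i\<le>Suc ?n. coeff (pCons 0 q) i * poly P (z - of_nat i * lam))
      = poly (shift_op lam q P) (z - lam)"
    by (subst sum.atMost_Suc_shift, subst poly_shift_op[of q ?n])
       (simp_all add: algebra_simps)
  finally show ?thesis .
qed

definition zeros_on_line :: "real \<Rightarrow> complex poly \<Rightarrow> bool" where
  "zeros_on_line c P \<longleftrightarrow> P = 0 \<or> (\<forall>z. poly P z = 0 \<longrightarrow> Im z = c)"

text \<open>On either side of the new line one of the points \<open>z\<close>, \<open>z - i \<mu>\<close> is strictly nearer to every
  zero of \<open>P\<close>, so the two terms cannot cancel.\<close>

lemma zeros_on_line_shift:
  assumes P: "zeros_on_line c P" and r: "cmod r = 1" and mu: "\<mu> \<noteq> 0"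
    and S: "\<And>z. poly S z = poly P (z - \<i> * of_real \<mu>) - r * poly P z"
  shows "zeros_on_line (c + \<mu> / 2) S"
proof (cases "degree P = 0")
  case True
  then obtain d where "P = [:d:]" using degree_eq_zeroE by blast
  then have "poly S = poly [:d * (1 - r):]" by (auto simp: S algebra_simps)
  then have "S = [:d * (1 - r):]" by (simp add: poly_eq_poly_eq_iff)
  then show ?thesis by (auto simp: zeros_on_line_def)
next
  case False
  then have root: "Im w = c" if "poly P w = 0" for w
    using P that by (auto simp: zeros_on_line_def)
  \<comment> \<open>The right-hand side does not depend on \<open>w\<close>: which point is nearer
    is the same for all zeros of \<open>P\<close>.\<close>
  have dist: "(norm (z - w))\<^sup>2 - (norm (z - \<i> * of_real \<mu> - w))\<^sup>2 = 2 * \<mu> * (Im z - (c + \<mu> / 2))"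
    if "poly P w = 0" for z w
    unfolding cmod_power2 by (simp add: root[OF that] power2_eq_square algebra_simps)
  have "Im z = c + \<mu> / 2" if z: "poly S z = 0" for z
  proof (rule ccontr)
    assume ne: "Im z \<noteq> c + \<mu> / 2"
    let ?d = "2 * \<mu> * (Im z - (c + \<mu> / 2))"
    have eq: "norm (poly P (z - \<i> * of_real \<mu>)) = norm (poly P z)"
      using z r by (simp add: S norm_mult)
    have "?d \<noteq> 0" using ne mu by simp
    then consider "?d > 0" | "?d < 0" by linarith
    then show False
    proof cases
      case 1
      then have "norm (z - \<i> * of_real \<mu> - w) < norm (z - w)" if "poly P w = 0" for w
        using dist[OF that, of z] by (auto intro: power2_less_imp_less[OF _ norm_ge_zero])
      then show False using norm_poly_less[of P "z - \<i> * of_real \<mu>" z] False eq by simp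
    next
      case 2
      then have "norm (z - w) < norm (z - \<i> * of_real \<mu> - w)" if "poly P w = 0" for w
        using dist[OF that, of z] by (auto intro: power2_less_imp_less[OF _ norm_ge_zero])
      then show False using norm_poly_less[of P z "z - \<i> * of_real \<mu>"] False eq by simp
    qed
  qed
  then show ?thesis by (auto simp: zeros_on_line_def)
qed

text \<open>Each linear factor of \<open>q\<close> has a unimodular root and moves the line by
  \<mu>\<open>/ 2\<close>.\<close>

lemma zeros_on_line_shift_op:
  assumes "q \<noteq> 0" and "\<And>t. poly q t = 0 \<Longrightarrow> cmod t = 1"
    and "zeros_on_line c P" and "\<mu> \<noteq> 0"
  shows "zeros_on_line (c + of_nat (degree q) * \<mu> / 2) (shift_op (\<i> * of_real \<mu>) q P)"
  using assms(1,2)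
proof (induction "degree q" arbitrary: q)
  case 0
  then obtain d where "q = [:d:]" "d \<noteq> 0" by (metis degree_eq_zeroE pCons_0_0)
  then show ?case using assms(3) by (simp add: shift_op_def zeros_on_line_def)
next
  case (Suc n)
  obtain r q' where q': "q = [:- r, 1:] * q'" "degree q' = n" "q' \<noteq> 0"
    using poly_root_factor[of q n] Suc.hyps(2) by metis
  have "zeros_on_line (c + of_nat n * \<mu> / 2) (shift_op (\<i> * of_real \<mu>) q' P)"
    using Suc.hyps(1)[of q'] q' Suc.prems(2) by simp
  moreover have "cmod r = 1" using Suc.prems(2)[of r] q'(1) by simp
  ultimately have "zeros_on_line (c + of_nat n * \<mu> / 2 + \<mu> / 2) (shift_op (\<i> * of_real \<mu>) q P)"
    using assms(4) poly_shift_op_linear_mult unfolding q'(1) by (rule zeros_on_line_shift)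
  then show ?case by (simp flip: Suc.hyps(2) add: field_simps)
qed

section \<open>Self-inversive polynomials\<close>

lemma map_poly_cnj_mult: "map_poly cnj (p * q) = map_poly cnj p * map_poly cnj q"
  by (intro poly_eq_poly_eq_iff[THEN iffD1] ext) simp

text \<open>For unimodular \<open>r\<close>, conjugating and reversing \<open>t - r\<close> gives
  \<open>1 - cnj r * t = - cnj r * (t - r)\<close>; both operations are multiplicative.\<close>

lemma reflect_cnj_unit_roots:
  assumes "q \<noteq> 0" and "\<And>t. poly q t = 0 \<Longrightarrow> cmod t = 1"
  obtains \<epsilon> where "reflect_poly (map_poly cnj q) = smult \<epsilon> q"
  using assms
proof (induction "degree q" arbitrary: q thesis)
  case 0
  then obtain d where "q = [:d:]" "d \<noteq> 0" by (metis degree_eq_zeroE pCons_0_0)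
  then show ?case using "0.prems"(1)[of "cnj d / d"] by (simp add: map_poly_pCons)
next
  case (Suc n)
  obtain r q' where q': "q = [:- r, 1:] * q'" "degree q' = n" "q' \<noteq> 0"
    using poly_root_factor[of q n] Suc.hyps(2) by metis
  obtain \<epsilon> where \<epsilon>: "reflect_poly (map_poly cnj q') = smult \<epsilon> q'"
    using Suc.hyps(1)[of q'] q' Suc.prems(3) by auto
  have "cmod r = 1" using Suc.prems(3)[of r] q'(1) by simp
  then have r: "cnj r * r = 1" by (metis complex_norm_square mult.commute of_real_1 one_power2)
  then have "r \<noteq> 0" by auto
  then have "reflect_poly (map_poly cnj [:- r, 1:]) = smult (- cnj r) [:- r, 1:]"
    using r by (simp add: map_poly_pCons reflect_poly_pCons)
  then have "reflect_poly (map_poly cnj q) = smult (\<epsilon> * - cnj r) q"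
    by (simp only: q'(1) map_poly_cnj_mult reflect_poly_mult \<epsilon> mult_smult_left mult_smult_right smult_smult)
  then show ?case by (rule Suc.prems(1))
qed

section \<open>From the generating function to a polynomial\<close>

definition gen_poly :: "int \<Rightarrow> int \<Rightarrow> (int \<Rightarrow> complex) \<Rightarrow> complex poly" where
  "gen_poly l m a = (\<Sum>k\<le>nat (m - l). monom (a (l + int k)) k)"

lemma coeff_gen_poly: "coeff (gen_poly l m a) k = (if k \<le> nat (m - l) then a (l + int k) else 0)"
  by (simp add: gen_poly_def coeff_sum)

lemma degree_gen_poly_le: "degree (gen_poly l m a) \<le> nat (m - l)"
  by (rule degree_le) (simp add: coeff_gen_poly)

lemma degree_gen_poly:
  assumes "l \<le> m" "a m \<noteq> 0"
  shows "degree (gen_poly l m a) = nat (m - l)"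
  using assms by (intro antisym degree_gen_poly_le le_degree) (simp add: coeff_gen_poly)

lemma sum_int_interval_eq:
  fixes l m :: int
  assumes "l \<le> m"
  shows "(\<Sum>j\<in>{l..m}. f j) = (\<Sum>k\<le>nat (m - l). f (l + int k))"
  using assms
  by (intro sum.reindex_bij_witness[of _ "\<lambda>k. l + int k" "\<lambda>j. nat (j - l)"]) auto

lemma gen_fun_eq_gen_poly:
  assumes "l \<le> m" "t \<noteq> 0"
  shows "gen_fun l m a t = t powi l * poly (gen_poly l m a) t"
  using assms
  by (simp add: gen_fun_def gen_poly_def sum_int_interval_eq poly_sum poly_monom
      sum_distrib_left power_int_add mult_ac)

text \<open>An identity principle for Laurent polynomials, applied later on a segment of a ray and
  on the punctured unit circle.\<close>

lemma gen_fun_eq_0_imp_coeff_0: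
  assumes "infinite A" and "\<And>t. t \<in> A \<Longrightarrow> t \<noteq> 0 \<and> gen_fun l m a t = 0" and "j \<in> {l..m}"
  shows "a j = 0"
proof -
  have lm: "l \<le> m" using assms(3) by auto
  have "A \<subseteq> {t. poly (gen_poly l m a) t = 0}"
    using assms(2) gen_fun_eq_gen_poly[OF lm, of _ a] by fastforce
  then have "gen_poly l m a = 0"
    using assms(1) poly_roots_finite finite_subset by metis
  then have "coeff (gen_poly l m a) (nat (j - l)) = 0" by simp
  then show ?thesis using assms(3) by (simp add: coeff_gen_poly split: if_splits)
qed

lemma poly_fin_diff_op:
  "poly (fin_diff_op l m a lam P) z = (\<Sum>j\<in>{l..m}. a j * poly P (z - of_int j * lam))"
  by (simp add: fin_diff_op_def poly_sum poly_pcompose)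

text \<open>The factor \<open>t powi l\<close> taken out of the generating function acts as a
  translation of the argument.\<close>

lemma poly_fin_diff_op_eq_shift_op:
  assumes "l \<le> m"
  shows "poly (fin_diff_op l m a lam P) z
           = poly (shift_op lam (gen_poly l m a) P) (z - of_int l * lam)"
  using assms
  by (simp add: poly_fin_diff_op sum_int_interval_eq poly_shift_op[OF degree_gen_poly_le]
      coeff_gen_poly algebra_simps)

section \<open>Locally uniform convergence of the Jensen polynomials\<close>

text \<open>With \<open>x = z / n\<close>, dividing by \<open>exp (norm x)\<close> puts
  \<open>exp x\<close> and \<open>1 + x\<close> into the unit disc, where n-th powers differ by at
  most \<open>n\<close> times the difference of the bases. Taylor's bound for \<open>exp\<close>
  finishes.\<close>

lemma norm_exp_minus_power_le:
  fixes z :: complex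
  assumes "n > 0"
  shows "norm (exp z - (1 + z / of_nat n) ^ n) \<le> exp (norm z) * (norm z)\<^sup>2 / real n"
proof -
  define x where "x = z / of_nat n"
  define e where "e = exp (norm x)"
  have e: "e > 0" and en: "e ^ n = exp (norm z)" and zn: "exp x ^ n = exp z"
    using assms by (simp_all add: e_def x_def norm_divide flip: exp_of_nat_mult)
  have "norm (exp x / of_real e) \<le> 1"
    using norm_exp[of x] e by (simp add: norm_divide e_def)
  moreover have "norm (1 + x) \<le> e"
    unfolding e_def
    by (rule order_trans[OF norm_triangle_ineq]) (simp add: exp_ge_add_one_self)
  then have "norm ((1 + x) / of_real e) \<le> 1"
    using e by (simp add: norm_divide)
  ultimately have "norm ((exp x / of_real e) ^ n - ((1 + x) / of_real e) ^ n)
      \<le> n * norm (exp x / of_real e - (1 + x) / of_real e)"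
    by (rule norm_power_diff)
  also have "exp x / of_real e - (1 + x) / of_real e = (exp x - (1 + x)) / of_real e"
    by (simp add: diff_divide_distrib)
  also have "norm \<dots> = norm (exp x - (1 + x)) / e"
    using e by (simp add: norm_divide)
  also have "\<dots> \<le> (norm x)\<^sup>2"
    using Taylor_exp_field[of x 1] e by (simp add: e_def field_simps power2_eq_square)
  also have "(exp x / of_real e) ^ n - ((1 + x) / of_real e) ^ n
      = (exp z - (1 + x) ^ n) / of_real (exp (norm z))"
    by (simp add: power_divide zn diff_divide_distrib flip: of_real_power en)
  finally have "norm (exp z - (1 + x) ^ n) / exp (norm z) \<le> n * (norm x)\<^sup>2"
    by (simp add: norm_divide mult_left_mono)
  also have "\<dots> = (norm z)\<^sup>2 / n"
    using assms by (simp add: x_def norm_divide power_divide power2_eq_square)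
  finally show ?thesis by (simp add: x_def field_simps)
qed

lemma uniform_limit_one_plus_power:
  fixes c :: complex
  assumes "bounded K"
  shows "uniform_limit K (\<lambda>n s. (1 + c * s / of_nat n) ^ n) (\<lambda>s. exp (c * s)) sequentially"
proof -
  obtain B where B: "\<And>s. s \<in> K \<Longrightarrow> norm s \<le> B" using assms bounded_iff by metis
  define C where "C = norm c * B"
  have C: "norm (c * s) \<le> C" if "s \<in> K" for s
    using B[OF that] by (simp add: C_def norm_mult mult_left_mono)
  have bound: "norm ((1 + c * s / of_nat n) ^ n - exp (c * s)) \<le> exp C * C\<^sup>2 / real n"
    if "n > 0" "s \<in> K" for n s
  proof -
    have "norm ((1 + c * s / of_nat n) ^ n - exp (c * s))
        \<le> exp (norm (c * s)) * (norm (c * s))\<^sup>2 / real n"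
      using norm_exp_minus_power_le[OF that(1), of "c * s"] by (simp add: norm_minus_commute)
    also have "\<dots> \<le> exp C * C\<^sup>2 / real n"
      using C[OF that(2)] by (intro divide_right_mono mult_mono power_mono) auto
    finally show ?thesis .
  qed
  show ?thesis
  proof (rule uniform_limitI)
    fix e :: real assume "e > 0"
    have "(\<lambda>n. exp C * C\<^sup>2 / real n) \<longlonglongrightarrow> 0" by (rule lim_const_over_n)
    then have "\<forall>\<^sub>F n in sequentially. exp C * C\<^sup>2 / real n < e"
      using \<open>e > 0\<close> by (rule order_tendstoD)
    then show "\<forall>\<^sub>F n in sequentially. \<forall>s\<in>K. dist ((1 + c * s / of_nat n) ^ n) (exp (c * s)) < e"
      using eventually_gt_at_top[of 0]
      by eventually_elim (auto simp: dist_norm intro: order_le_less_trans[OF bound])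
  qed
qed

lemma gen_fun_exp:
  "gen_fun l m a (exp (- lam * s)) = (\<Sum>j\<in>{l..m}. a j * exp ((- of_int j * lam) * s))"
  by (simp add: gen_fun_def exp_power_int mult_ac)

text \<open>The Jensen polynomials of \<open>s \<mapsto> gen_fun l m a (exp (- lam * s))\<close> are the reversed images of
  the powers of the variable.\<close>

definition jensen_poly :: "int \<Rightarrow> int \<Rightarrow> (int \<Rightarrow> complex) \<Rightarrow> complex \<Rightarrow> nat \<Rightarrow> complex \<Rightarrow> complex" where
  "jensen_poly l m a lam n s = (\<Sum>j\<in>{l..m}. a j * (1 + (- of_int j * lam) * s / of_nat n) ^ n)"

lemma uniform_limit_jensen_poly:
  assumes "bounded K"
  shows "uniform_limit K (jensen_poly l m a lam) (\<lambda>s. gen_fun l m a (exp (- lam * s))) sequentially"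
  unfolding jensen_poly_def[abs_def] gen_fun_exp
proof -
  have "uniform_limit K (\<lambda>n s. \<Sum>j\<in>J. a j * (1 + (- of_int j * lam) * s / of_nat n) ^ n)
      (\<lambda>s. \<Sum>j\<in>J. a j * exp ((- of_int j * lam) * s)) sequentially" if "finite J" for J
    using that
  proof induction
    case (insert j J)
    then show ?case
      unfolding sum.insert[OF insert.hyps]
      by (intro uniform_limit_add bounded_linear_uniform_limit_intros uniform_limit_one_plus_power assms)
  qed (simp add: uniform_limit_const)
  then show "uniform_limit K (\<lambda>n s. \<Sum>j\<in>{l..m}. a j * (1 + (- of_int j * lam) * s / of_nat n) ^ n)
      (\<lambda>s. \<Sum>j\<in>{l..m}. a j * exp ((- of_int j * lam) * s)) sequentially" by simp
qed

text \<open>The substitution \<open>s\<close> to \<open>n / s\<close> preserves being real and being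
  non-real, so facts about the image of the monomial carry over to the Jensen polynomial.\<close>

lemma jensen_poly_eq_fin_diff_op:
  assumes "s \<noteq> 0" "n > 0"
  shows "poly (fin_diff_op l m a lam (monom 1 n)) (of_nat n / s)
           = (of_nat n / s) ^ n * jensen_poly l m a lam n s"
proof -
  have "(of_nat n / s - of_int j * lam) ^ n
      = (of_nat n / s) ^ n * (1 + (- of_int j * lam) * s / of_nat n) ^ n" for j
    using assms by (simp add: field_simps flip: power_mult_distrib)
  then show ?thesis
    by (simp add: poly_fin_diff_op poly_monom jensen_poly_def sum_distrib_left mult_ac)
qed

section \<open>Necessity: reality and zeros of the limit function\<close>

lemma preserves_HP_monom:
  assumes "preserves_HP T"
  obtains R where "hyperbolic R" "T (monom 1 n) = complexify R"
proof -
  have "poly (complexify (monom 1 n)) z = z ^ n" for z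
    by (simp add: map_poly_monom poly_monom)
  then have "monom 1 n \<in> HP" by (simp add: HP_def hyperbolic_def)
  then have "T (complexify (monom 1 n)) \<in> complexify ` HP"
    using assms by (auto simp: preserves_HP_def)
  then show thesis using that by (auto simp: HP_def map_poly_monom)
qed

lemma complexify_cnj: "poly (complexify R) (cnj z) = cnj (poly (complexify R) z)"
  by (simp add: poly_cnj map_poly_map_poly o_def)

text \<open>Images of monomials have real coefficients, so the Jensen polynomials are real at
  \<open>s\<close>, and the reals are closed.\<close>

lemma gen_fun_exp_real:
  assumes T: "preserves_HP (fin_diff_op l m a lam)" and s: "s \<in> \<real>" "s \<noteq> 0"
  shows "gen_fun l m a (exp (- lam * s)) \<in> \<real>"
proof -
  have lim: "(\<lambda>n. jensen_poly l m a lam n s) \<longlonglongrightarrow> gen_fun l m a (exp (- lam * s))"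
    using uniform_limit_jensen_poly[of "{s}"] by (rule tendsto_uniform_limitI) auto
  have "\<forall>\<^sub>F n in sequentially. jensen_poly l m a lam n s \<in> \<real>"
    using eventually_gt_at_top[of 0]
  proof eventually_elim
    case (elim n)
    obtain R where R: "fin_diff_op l m a lam (monom 1 n) = complexify R"
      using preserves_HP_monom[OF T] by metis
    have ns: "of_nat n / s \<in> \<real>" "of_nat n / s \<noteq> 0" using s elim by auto
    have "poly (complexify R) (of_nat n / s) \<in> \<real>"
      using ns(1) complexify_cnj[of R "of_nat n / s"] by (metis Reals_cnj_iff)
    then have "(of_nat n / s) ^ n * jensen_poly l m a lam n s \<in> \<real>"
      using jensen_poly_eq_fin_diff_op[OF s(2) elim, of l m a lam] by (simp add: R)
    then have "(of_nat n / s) ^ n * jensen_poly l m a lam n s / (of_nat n / s) ^ n \<in> \<real>"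
      by (rule Reals_divide) (rule Reals_power[OF ns(1)])
    then show ?case using ns(2) by simp
  qed
  then show ?thesis
    using closed_complex_Reals lim Lim_in_closed_set[of "\<real>"] by (metis sequentially_bot)
qed

text \<open>Hurwitz's theorem on a disc off the real axis, where the nonzero Jensen polynomials have
  no zeros.\<close>

lemma gen_fun_exp_zero_real:
  assumes T: "preserves_HP (fin_diff_op l m a lam)" and lm: "l \<le> m" "a l \<noteq> 0" and lam: "lam \<noteq> 0"
    and zero: "gen_fun l m a (exp (- lam * s0)) = 0"
  shows "s0 \<in> \<real>"
proof (rule ccontr)
  assume s0: "s0 \<notin> \<real>"
  define g where "g = (\<lambda>s. gen_fun l m a (exp (- lam * s)))"
  have "open (- \<real> :: complex set)" using closed_complex_Reals by auto
  then obtain e where e: "e > 0" "ball s0 e \<subseteq> - \<real>"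
    using s0 open_contains_ball by (metis ComplI)
  have nonconst: "\<exists>s\<in>ball s0 e. g s \<noteq> 0"
  proof (rule ccontr)
    assume "\<not> ?thesis"
    then have z: "g s = 0" if "s \<in> ball s0 e" for s using that by blast
    define d where "d = e * cmod lam"
    have d: "d > 0" using e lam by (simp add: d_def)
    \<comment> \<open>Moving from \<open>s0\<close> in direction \<open>1 / lam\<close> scales the
      exponential by \<open>exp (- x)\<close>, which is injective in \<open>x\<close>;
      \<open>x < d\<close> keeps the point in the ball.\<close>
    let ?f = "\<lambda>x::real. exp (- lam * (s0 + of_real x / lam))"
    have "inj_on ?f {0<..<d}"
    proof (rule inj_onI)
      fix x y assume "?f x = ?f y"
      moreover have "?f x = exp (- lam * s0) * of_real (exp (- x))" for x
        using lam by (simp add: distrib_left flip: exp_add exp_of_real)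
      ultimately show "x = y" by simp
    qed
    then have "infinite (?f ` {0<..<d})"
      using d by (simp add: finite_image_iff)
    moreover have "t \<noteq> 0 \<and> gen_fun l m a t = 0" if t: "t \<in> ?f ` {0<..<d}" for t
    proof -
      obtain x where x: "0 < x" "x < d" "t = ?f x" using t by auto
      then have "s0 + of_real x / lam \<in> ball s0 e"
        using lam by (simp add: dist_norm norm_divide d_def field_simps)
      from z[OF this] show ?thesis by (simp add: x(3) g_def)
    qed
    ultimately have "a l = 0" using lm(1) by (intro gen_fun_eq_0_imp_coeff_0) auto
    then show False using lm by simp
  qed
  then obtain s1 where s1: "s1 \<in> ball s0 e" "g s1 \<noteq> 0" by blast
  \<comment> \<open>The image of a monomial might be zero, which counts as hyperbolic. The point
    \<open>s1\<close> excludes this for large \<open>n\<close>.\<close>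
  have "(\<lambda>n. jensen_poly l m a lam n s1) \<longlonglongrightarrow> g s1"
    unfolding g_def using uniform_limit_jensen_poly[of "{s1}"] by (rule tendsto_uniform_limitI) auto
  then have "\<forall>\<^sub>F n in sequentially. jensen_poly l m a lam n s1 \<noteq> 0"
    using s1(2) by (rule tendsto_imp_eventually_ne)
  then obtain N where N: "\<And>n. n \<ge> N \<Longrightarrow> jensen_poly l m a lam n s1 \<noteq> 0"
    by (auto simp: eventually_sequentially)
  have nz: "jensen_poly l m a lam k s \<noteq> 0" if s: "s \<in> ball s0 e" and k: "k \<ge> N" "k > 0" for k s
  proof
    assume 0: "jensen_poly l m a lam k s = 0"
    obtain R where R: "hyperbolic R" "fin_diff_op l m a lam (monom 1 k) = complexify R"
      using preserves_HP_monom[OF T] by metis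
    have sR: "s \<notin> \<real>" "s1 \<notin> \<real>" using s s1(1) e(2) by auto
    then have nz: "s \<noteq> 0" "s1 \<noteq> 0" by auto
    have "poly (complexify R) (of_nat k / s) = 0"
      using jensen_poly_eq_fin_diff_op[OF nz(1) k(2), of l m a lam] 0 R(2) by simp
    moreover have "poly (complexify R) (of_nat k / s1) \<noteq> 0"
      using jensen_poly_eq_fin_diff_op[OF nz(2) k(2), of l m a lam] N[OF k(1)] R(2) nz k(2) by simp
    then have "R \<noteq> 0" by auto
    ultimately have "of_nat k / s \<in> \<real>" using R(1) by (auto simp: hyperbolic_def)
    from Reals_divide[OF Reals_of_nat this, of k] have "s \<in> \<real>"
      using nz(1) k(2) by simp
    then show False using sR(1) by simp
  qed
  have "g s0 \<noteq> 0"
  \<comment> \<open>The offset \<open>Suc N\<close> makes every index both at least \<open>N\<close>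
    and positive, as \<open>nz\<close> requires.\<close>
  proof (rule Hurwitz_no_zeros[of "ball s0 e" "\<lambda>n. jensen_poly l m a lam (n + Suc N)" g])
    show "jensen_poly l m a lam (n + Suc N) holomorphic_on ball s0 e" for n
      unfolding jensen_poly_def by (intro holomorphic_intros) auto
    show "g holomorphic_on ball s0 e"
      unfolding g_def gen_fun_exp by (intro holomorphic_intros)
    show "uniform_limit K (\<lambda>n. jensen_poly l m a lam (n + Suc N)) g sequentially"
      if "compact K" "K \<subseteq> ball s0 e" for K
      unfolding g_def
      by (rule filterlim_compose[OF uniform_limit_jensen_poly filterlim_add_const_nat_at_top])
         (simp add: that compact_imp_bounded)
    show "\<not> g constant_on ball s0 e"
      using nonconst zero e(1) by (force simp: constant_on_def g_def)
  qed (use nz e in auto)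
  then show False using zero by (simp add: g_def)
qed

text \<open>Every logarithm of a root is a real multiple of \<open>lam\<close>. Two logarithms of
  one root differ by \<open>2 * pi * i\<close>, which makes \<open>lam\<close> imaginary, and then
  so are all these logarithms.\<close>

lemma preserves_HP_imp_imaginary_and_roots:
  assumes T: "preserves_HP (fin_diff_op l m a lam)" and lm: "l < m" "a l \<noteq> 0" "a m \<noteq> 0"
    and lam: "lam \<noteq> 0"
  shows "Re lam = 0" and "t \<noteq> 0 \<Longrightarrow> gen_fun l m a t = 0 \<Longrightarrow> cmod t = 1"
proof -
  have log_real: "w / lam \<in> \<real>" if "gen_fun l m a (exp w) = 0" for w
  proof -
    have "gen_fun l m a (exp (- lam * (- (w / lam)))) = 0" using that lam by simp
    then have "- (w / lam) \<in> \<real>"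
      using lm by (intro gen_fun_exp_zero_real[OF T _ _ lam]) auto
    then show ?thesis using Reals_minus by fastforce
  qed
  let ?q = "gen_poly l m a"
  have "degree ?q = Suc (nat (m - l - 1))"
    using degree_gen_poly[of l m a] lm by simp
  then obtain r q' where "?q = [:- r, 1:] * q'" by (rule poly_root_factor)
  then have r: "poly ?q r = 0" by simp
  \<comment> \<open>The constant coefficient is \<open>a l\<close>, so the root \<open>r\<close> is
    nonzero and has logarithms.\<close>
  have "poly ?q 0 \<noteq> 0" using lm by (simp add: poly_0_coeff_0 coeff_gen_poly)
  with r have r0: "r \<noteq> 0" by auto
  then have zr: "gen_fun l m a r = 0" using r lm by (simp add: gen_fun_eq_gen_poly)
  have "(Ln r + 2 * of_real pi * \<i>) / lam \<in> \<real>" "Ln r / lam \<in> \<real>"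
    using zr r0 by (auto intro!: log_real simp: exp_add)
  then have "(Ln r + 2 * of_real pi * \<i>) / lam - Ln r / lam \<in> \<real>" by (rule Reals_diff)
  then have "2 * of_real pi * \<i> / lam \<in> \<real>" by (simp add: add_divide_distrib)
  then obtain x where x: "2 * of_real pi * \<i> / lam = of_real x" by (auto elim: Reals_cases)
  then have "x \<noteq> 0" using lam by auto
  then have lam_eq: "lam = \<i> * of_real (2 * pi / x)" using x lam by (simp add: field_simps)
  then show re: "Re lam = 0" by simp
  show "cmod t = 1" if t: "t \<noteq> 0" "gen_fun l m a t = 0"
  proof -
    have "Ln t / lam \<in> \<real>" using t by (intro log_real) simp
    then obtain y where "Ln t / lam = of_real y" by (auto elim: Reals_cases)
    then have "Ln t = of_real y * lam" using lam by (simp add: field_simps)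
    then have "Re (Ln t) = 0" using re by simp
    then show ?thesis using t(1) by simp
  qed
qed

section \<open>Necessity: symmetry of the coefficients\<close>

lemma infinite_unit_circle: "infinite (sphere (0::complex) 1)"
proof
  assume "finite (sphere (0::complex) 1)"
  moreover have "connected (sphere (0::complex) 1)" by (intro connected_sphere) simp
  ultimately consider "sphere (0::complex) 1 = {}" | c where "sphere (0::complex) 1 = {c}"
    using connected_finite_iff_sing by metis
  then show False
  proof cases
    case 2
    moreover have "1 \<in> sphere (0::complex) 1" "- 1 \<in> sphere (0::complex) 1" by simp_all
    ultimately have "1 = c" "- 1 = c" by simp_all
    then show False by simp
  qed auto
qed

lemma gen_fun_real_imp_coeff_cnj:
  fixes a :: "int \<Rightarrow> complex"
  assumes real: "\<And>u. cmod u = 1 \<Longrightarrow> u \<noteq> 1 \<Longrightarrow> gen_fun l m a u \<in> \<real>"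
  defines "b \<equiv> \<lambda>j. if j \<in> {l..m} then a j else 0"
  shows "b (- j) = cnj (b j)"
proof -
  \<comment> \<open>A range symmetric about 0 allows the substitution of \<open>- i\<close> for
    \<open>i\<close>.\<close>
  define N where "N = max (max \<bar>l\<bar> \<bar>m\<bar>) \<bar>j\<bar>"
  have b_sum: "gen_fun l m a u = (\<Sum>i\<in>{-N..N}. b i * u powi i)" for u
    unfolding gen_fun_def by (intro sum.mono_neutral_cong_left) (auto simp: b_def N_def)
  let ?d = "\<lambda>i. b (- i) - cnj (b i)"
  have "u \<noteq> 0 \<and> gen_fun (- N) N ?d u = 0" if u: "u \<in> sphere 0 1 - {1}" for u
  proof
    have u1: "cmod u = 1" "u \<noteq> 1" using u by auto
    have cu: "cnj u = inverse u"
      using u1 complex_norm_square[of u] by (intro inverse_unique[symmetric]) simp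
    show u0: "u \<noteq> 0" using u1 by auto
    have "cmod (cnj u) = 1" "cnj u \<noteq> 1" using u1 by (auto simp: complex_eq_iff)
    from real[OF this] have "cnj (gen_fun l m a (cnj u)) = gen_fun l m a (cnj u)"
      by (simp only: Reals_cnj_iff)
    moreover have "cnj (gen_fun l m a (cnj u)) = (\<Sum>i\<in>{-N..N}. cnj (b i) * u powi i)"
      by (simp add: b_sum)
    moreover have "gen_fun l m a (cnj u) = (\<Sum>i\<in>{-N..N}. b (- i) * u powi i)"
      unfolding b_sum
      by (rule sum.reindex_bij_witness[of _ uminus uminus])
         (auto simp: cu power_int_minus power_int_inverse)
    ultimately show "gen_fun (- N) N ?d u = 0"
      by (simp add: gen_fun_def algebra_simps sum_subtractf)
  qed
  then have "?d j = 0"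
    using infinite_unit_circle
    by (intro gen_fun_eq_0_imp_coeff_0[of "sphere 0 1 - {1}" "- N" N]) (auto simp: N_def)
  then show ?thesis by simp
qed

lemma preserves_HP_imp_symmetric:
  assumes T: "preserves_HP (fin_diff_op l m a lam)" and lm: "l < m" "a l \<noteq> 0" "a m \<noteq> 0"
    and lam: "lam \<noteq> 0" "Re lam = 0"
  shows "l = - m" and "a (- m) = cnj (a m)"
proof -
  have lam_eq: "lam = \<i> * of_real (Im lam)" using lam by (simp add: complex_eq_iff)
  have "gen_fun l m a u \<in> \<real>" if u: "cmod u = 1" "u \<noteq> 1" for u
  proof -
    have u0: "u \<noteq> 0" using u by auto
    \<comment> \<open>Solves \<open>exp (- lam * s) = u\<close>; it is real as a quotient of two
      imaginary numbers.\<close>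
    define s where "s = - Ln u / lam"
    have "Ln u = \<i> * of_real (Im (Ln u))" using u u0 by (simp add: complex_eq_iff)
    then have "s = - (\<i> * of_real (Im (Ln u))) / (\<i> * of_real (Im lam))"
      using lam_eq by (simp add: s_def)
    then have "s = of_real (- Im (Ln u) / Im lam)" by simp
    then have "s \<in> \<real>" by (metis Reals_of_real)
    moreover have "exp (- lam * s) = u" using lam u0 by (simp add: s_def)
    moreover from this have "s \<noteq> 0" using u(2) by auto
    ultimately show ?thesis using gen_fun_exp_real[OF T, of s] by simp
  qed
  note sym = gen_fun_real_imp_coeff_cnj[OF this]
  \<comment> \<open>Both end coefficients are nonzero, so their mirror images cannot lie where the
    extension is zero.\<close>
  have "- m \<in> {l..m}" "- l \<in> {l..m}"
    using sym[of m] sym[of l] lm by (auto split: if_splits)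
  then show "l = - m" by auto
  then show "a (- m) = cnj (a m)" using sym[of m] lm by auto
qed

section \<open>Sufficiency\<close>

lemma unit_roots_imp_coeff_cnj:
  assumes m: "m > 0" "a m \<noteq> 0" "a (- m) \<noteq> 0"
    and roots: "gen_fun_roots (- m) m a \<subseteq> {z. cmod z = 1}"
    and pos: "a (- m) * a m \<in> complex_of_real ` {0<..}"
  shows "gen_poly (- m) m a \<noteq> 0"
    and "poly (gen_poly (- m) m a) t = 0 \<Longrightarrow> cmod t = 1"
    and "j \<in> {- m..m} \<Longrightarrow> cnj (a j) = a (- j)"
proof -
  let ?q = "gen_poly (- m) m a"
  have deg: "degree ?q = nat (m + m)" using degree_gen_poly[of "- m" m a] m by simp
  show q0: "?q \<noteq> 0" using deg m by auto
  have "poly ?q 0 \<noteq> 0" using m by (simp add: poly_0_coeff_0 coeff_gen_poly)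
  then show unit: "cmod t = 1" if "poly ?q t = 0" for t
  proof -
    have "t \<noteq> 0" using that \<open>poly ?q 0 \<noteq> 0\<close> by auto
    then have "gen_fun (- m) m a t = 0"
      using that m by (subst gen_fun_eq_gen_poly) auto
    then show ?thesis using \<open>t \<noteq> 0\<close> roots by (auto simp: gen_fun_roots_def)
  qed
  obtain \<epsilon> where \<epsilon>: "reflect_poly (map_poly cnj ?q) = smult \<epsilon> ?q"
    using reflect_cnj_unit_roots[OF q0 unit] by blast
  \<comment> \<open>Coefficient \<open>k\<close> of \<open>?q\<close> is \<open>a (k - m)\<close>,
    so reversal in degree \<open>2 * m\<close> exchanges \<open>j\<close> and
    \<open>- j\<close>.\<close>
  have sym: "cnj (a (- j)) = \<epsilon> * a j" if j: "j \<in> {- m..m}" for j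
  proof -
    have "coeff (reflect_poly (map_poly cnj ?q)) (nat (j + m)) = cnj (coeff ?q (nat (m - j)))"
      using j by (simp add: coeff_reflect_poly degree_map_poly deg coeff_map_poly nat_diff_distrib[symmetric])
    moreover have "coeff ?q (nat (j + m)) = a j" "coeff ?q (nat (m - j)) = a (- j)"
      using j by (auto simp: coeff_gen_poly nat_mono)
    ultimately show ?thesis by (simp add: \<epsilon>)
  qed
  obtain p where p: "p > 0" "a (- m) * a m = complex_of_real p" using pos by auto
  have m1: "cnj (a (- m)) = \<epsilon> * a m" and m2: "cnj (a m) = \<epsilon> * a (- m)"
    using sym[of m] sym[of "- m"] m by auto
  \<comment> \<open>The product is real and nonzero, so the factor is 1 or -1; its positive sign
    then excludes -1.\<close>
  have "cnj (a (- m) * a m) = \<epsilon>\<^sup>2 * (a (- m) * a m)"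
    by (simp add: m1 m2 power2_eq_square)
  then have "\<epsilon>\<^sup>2 = 1" using p by simp
  moreover have "\<epsilon> \<noteq> - 1"
  proof
    assume "\<epsilon> = - 1"
    then have "complex_of_real ((cmod (a (- m)))\<^sup>2) = of_real (- p)"
      using m1 p(2) complex_norm_square[of "a (- m)"] by simp
    then have "(cmod (a (- m)))\<^sup>2 = - p" by (simp only: of_real_eq_iff)
    then show False using p(1) by (smt (verit) zero_le_power2)
  qed
  ultimately have "\<epsilon> = 1" by (simp add: power2_eq_1_iff)
  then show "cnj (a j) = a (- j)" if "j \<in> {- m..m}" for j
    using sym[of "- j"] that by simp
qed

lemma cnj_symmetric_imp_complexify:
  assumes "\<And>z. poly R (cnj z) = cnj (poly R z)"
  shows "R = complexify (map_poly Re R)"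
proof -
  have "poly (map_poly cnj R) z = poly R z" for z
    using assms[of z] by simp
  then have "map_poly cnj R = R" by (intro poly_eq_poly_eq_iff[THEN iffD1] ext)
  then have "coeff (map_poly cnj R) n = coeff R n" for n by simp
  then have "cnj (coeff R n) = coeff R n" for n by (simp add: coeff_map_poly)
  then show ?thesis
    by (intro poly_eqI) (simp add: coeff_map_poly complex_eq_iff)
qed

lemma imaginary_unit_roots_imp_preserves_HP:
  assumes lam: "Re lam = 0" "lam \<noteq> 0" and m: "m > 0" "a m \<noteq> 0" "a (- m) \<noteq> 0"
    and roots: "gen_fun_roots (- m) m a \<subseteq> {z. cmod z = 1}"
    and pos: "a (- m) * a m \<in> complex_of_real ` {0<..}"
  shows "preserves_HP (fin_diff_op (- m) m a lam)"
  unfolding preserves_HP_def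
proof
  fix P assume "P \<in> HP"
  then have P: "zeros_on_line 0 (complexify P)"
    by (auto simp: HP_def hyperbolic_def zeros_on_line_def complex_is_Real_iff)
  let ?R = "fin_diff_op (- m) m a lam (complexify P)"
  let ?q = "gen_poly (- m) m a"
  note coeffs = unit_roots_imp_coeff_cnj[OF m roots pos]
  have lam_eq: "lam = \<i> * of_real (Im lam)" and mu: "Im lam \<noteq> 0" and cl: "cnj lam = - lam"
    using lam by (auto simp: complex_eq_iff)
  \<comment> \<open>Conjugation turns \<open>lam\<close> into \<open>- lam\<close> and
    \<open>a j\<close> into \<open>a (- j)\<close>; replacing \<open>j\<close> by \<open>- j\<close>
    undoes both.\<close>
  have "poly ?R (cnj z) = cnj (poly ?R z)" for z
    unfolding poly_fin_diff_op cnj_sum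
  proof (rule sum.reindex_bij_witness[of _ uminus uminus])
    fix j assume j: "j \<in> {- m..m}"
    show "cnj (a (- j) * poly (complexify P) (z - of_int (- j) * lam))
        = a j * poly (complexify P) (cnj z - of_int j * lam)"
      using coeffs(3)[of "- j"] j
      by (simp only: complex_cnj_mult complexify_cnj[symmetric]) (simp add: cl)
  qed auto
  then have real: "?R = complexify (map_poly Re ?R)" by (rule cnj_symmetric_imp_complexify)
  have line: "zeros_on_line (of_int m * Im lam) (shift_op lam ?q (complexify P))"
  proof -
    have "degree ?q = nat (m + m)" using degree_gen_poly[of "- m" m a] m by simp
    then have "0 + of_nat (degree ?q) * Im lam / 2 = of_int m * Im lam" using m by simp
    moreover have "zeros_on_line (0 + of_nat (degree ?q) * Im lam / 2)
        (shift_op (\<i> * of_real (Im lam)) ?q (complexify P))"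
      using coeffs(1,2) P mu by (rule zeros_on_line_shift_op)
    ultimately show ?thesis by (simp only: lam_eq[symmetric])
  qed
  have "hyperbolic (map_poly Re ?R)"
  proof (cases "shift_op lam ?q (complexify P) = 0")
    case True
    then have "poly ?R z = 0" for z using poly_fin_diff_op_eq_shift_op[of "- m" m] m by simp
    then have "?R = 0" by (intro poly_eq_poly_eq_iff[THEN iffD1] ext) simp
    then show ?thesis by (simp add: hyperbolic_def)
  next
    case False
    have "Im z = 0" if "poly ?R z = 0" for z
    proof -
      have "poly (shift_op lam ?q (complexify P)) (z - of_int (- m) * lam) = 0"
        using that poly_fin_diff_op_eq_shift_op[of "- m" m a lam] m by simp
      \<comment> \<open>The \<open>2 * m\<close> half-steps raised the line by
        \<open>m * Im lam\<close>; the translation brings it back to the real axis.\<close>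
      then have "Im (z - of_int (- m) * lam) = of_int m * Im lam"
        using line False unfolding zeros_on_line_def by blast
      then show ?thesis by simp
    qed
    then show ?thesis unfolding hyperbolic_def real[symmetric] by (simp add: complex_is_Real_iff)
  qed
  then have "map_poly Re ?R \<in> HP" by (simp add: HP_def)
  with real show "?R \<in> complexify ` HP" by (rule image_eqI[where x = "map_poly Re ?R"])
qed

theorem theorem1p1:
  fixes l m :: int and a :: "int \<Rightarrow> complex" and lam :: complex
  assumes "l < m" and "a l \<noteq> 0" and "a m \<noteq> 0" and "lam \<noteq> 0"
  shows "preserves_HP (fin_diff_op l m a lam) \<longleftrightarrow>
           Re lam = 0 \<and>
           l = - m \<and>
           gen_fun_roots l m a \<subseteq> {z. cmod z = 1} \<and>
           a (- m) * a m \<in> complex_of_real ` {0<..}"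
proof
  assume T: "preserves_HP (fin_diff_op l m a lam)"
  have re: "Re lam = 0" and roots: "\<And>t. t \<noteq> 0 \<Longrightarrow> gen_fun l m a t = 0 \<Longrightarrow> cmod t = 1"
    using preserves_HP_imp_imaginary_and_roots[OF T assms] by blast+
  have l: "l = - m" and am: "a (- m) = cnj (a m)"
    using preserves_HP_imp_symmetric[OF T assms re] by blast+
  have "a (- m) * a m = of_real ((cmod (a m))\<^sup>2)"
    by (simp only: am complex_norm_square mult.commute)
  moreover have "(cmod (a m))\<^sup>2 \<in> {0<..}" using assms(3) by simp
  ultimately have "a (- m) * a m \<in> complex_of_real ` {0<..}" by (rule image_eqI)
  \<comment> \<open>The point 0 counts as a root only for \<open>0 \<le> l\<close>, which
    \<open>l = - m\<close> and \<open>l < m\<close> rule out.\<close>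
  then show "Re lam = 0 \<and> l = - m \<and> gen_fun_roots l m a \<subseteq> {z. cmod z = 1} \<and>
      a (- m) * a m \<in> complex_of_real ` {0<..}"
    using re roots l assms(1) by (auto simp: gen_fun_roots_def)
next
  assume R: "Re lam = 0 \<and> l = - m \<and> gen_fun_roots l m a \<subseteq> {z. cmod z = 1} \<and>
      a (- m) * a m \<in> complex_of_real ` {0<..}"
  then have l: "l = - m" by blast
  show "preserves_HP (fin_diff_op l m a lam)"
    unfolding l
    by (rule imaginary_unit_roots_imp_preserves_HP) (use R assms in auto)
qed

end
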